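(* In the fast-slow skew-product setting described in the context, let $\mathcal L\subset\mathsf{Att}(\psi)\ltimes\Pi_0[\mathsf{Att}]$ be a finite meet-semilattice, for each $u\in\mathcal L$ let $K(u)\in\mathsf{SANbhd}(\Phi_0)$ be a chosen singular attracting neighborhood associated with $u$, with threshold $\epsilon_1(u)>0$, let $\epsilon_{\mathcal L}:=\min_{u\in\mathcal L}\epsilon_1(u)>0$, and let $\mathcal K(\mathcal L)$ be the singular attracting neighborhood lattice generated by $\mathcal L$. Then for every $0<\epsilon\le\epsilon_{\mathcal L}$ the map $$\mathrm{Inv}(\,\cdot\,,\Phi_\epsilon)\colon\mathcal K(\mathcal L)\to\mathsf{Att}(\Phi_\epsilon)$$ is a lattice homomorphism. In particular, $\mathcal A_\epsilon(\mathcal L):=\mathrm{Inv}(\mathcal K(\mathcal L),\Phi_\epsilon)=\{\mathrm{Inv}(N,\Phi_\epsilon)\mid N\in\mathcal K(\mathcal L)\}\subset\mathsf{Att}(\Phi_\epsilon)$ is a finite distributive sublattice.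
   Context: General notions. For a continuous semiflow $\theta\colon\mathbb{R}^+\times Z\to Z$ on a compact metric space $Z$ (not assumed injective or surjective): $S$ is invariant if $\theta(t,S)=S$ for all $t\ge0$; $\mathrm{Inv}(U,\theta)$ is the union of all invariant subsets of $U$; $\omega_\theta(U)=\bigcap_{t\ge0}\mathrm{cl}(\theta([t,\infty),U))$; $U$ is an attracting neighborhood if for some $\tau>0$, $\theta(t,\mathrm{cl}\,U)\subset\mathrm{int}\,U$ for all $t\ge\tau$, and an attracting block if this inclusion holds for all $t>0$; attractors are the sets $\omega_\theta(U)=\mathrm{Inv}(U,\theta)$ with $U$ an attracting neighborhood; $\mathsf{Att}(\theta)$ is the bounded distributive lattice of attractors with $\vee=\cup$, $A\wedge B=\omega_\theta(A\cap B)=\mathrm{Inv}(A\cap B,\theta)$. Bounded distributive lattices have maximal and minimal elements, and homomorphisms between them preserve these elements. Setting. $X,Y$ are compact metric spaces. For $\epsilon\ge0$, $\Phi_\epsilon\colon\mathbb{R}^+\times X\times Y\to X\times Y$, $\Phi_\epsilon(t,x,y)=(\phi_\epsilon(t,x,y),\psi_\epsilon(t,y))$, is a skew-product flow, where $\psi_\epsilon(t,y)=\psi(\epsilon t,y)$ is the flow of $\dot y=\epsilon g(y)$, and $\Phi_\epsilon\to\Phi_0$ uniformly on compact sets as $\epsilon\to0$. Here $\phi_0\colon\mathbb{R}^+\times X\times Y\to X$ is the parametrized flow of $\dot x=f(x,y)$ with $y$ a fixed parameter, so $\Phi_0(t,x,y)=(\phi_0(t,x,y),y)$; write $\phi_0^y=\phi_0(\cdot,\cdot,y)$,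 a semiflow on $X$. For all $\epsilon>0$ the $\psi_\epsilon$ have the same attractors as $\psi$. Sections and cascade. For open $U\subset Y$, $\Pi_0[\mathsf{Att}](U)$ is the set of (continuous) sections over $U$: assignments $y\mapsto\sigma(y)\in\mathsf{Att}(\phi_0^y)$ such that each $y\in U$ has a neighborhood $V\subset U$ and a set $N\subset X$ that is an attracting neighborhood for $\phi_0^{y'}$ with $\omega_{\phi_0^{y'}}(N)=\sigma(y')$ for all $y'\in V$. The cascade $\mathsf{Att}(\psi)\ltimes\Pi_0[\mathsf{Att}]$ is the set of pairs $(A,\sigma)$ with $A\in\mathsf{Att}(\psi)$ and $\sigma$ the germ at $A$ of a section over some open $U\supset A$ with $\omega_\psi(U)=A$ (sections agreeing on some open attracting neighborhood of $A$ are identified). It is a meet-semilattice under $(A,\sigma)\wedge(B,\tau)=(A\cap B,\sigma|_{A\cap B}\wedge\tau|_{A\cap B})$, with $(\sigma\wedge\tau)(y)=\sigma(y)\wedge\tau(y)$ in $\mathsf{Att}(\phi_0^y)$. Singular attracting neighborhoods. A set $K\subset X\times Y$ is a singular attracting neighborhood if $K$ is not an attracting neighborhood for $\Phi_0$, but there exists $\epsilon_K>0$ such that $K$ is an attracting neighborhood for $\Phi_\epsilon$ for all $\epsilon\in(0,\epsilon_K]$. $\mathsf{SANbhd}(\Phi_0)$ is the collection of singular attracting neighborhoods, regarded as a bounded distributive lattice under $\wedge=\cap$, $\vee=\cup$. To $u=(A,\sigma)$, with $\sigma$ defined on $U$, a compact singular attracting neighborhood $K(u)$ is associated as follows: choose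 finitely many $y_i\in A$, open $V_{y_i}\ni y_i$ with $\mathrm{cl}(V_{y_i})\subset U$ and $A\subset\bigcup_iV_{y_i}$, compact $N_i\subset X$ and $T_i>0$ such that for all $y'\in\mathrm{cl}(V_{y_i})$: $\phi_0(t,N_i,y')\subset\mathrm{int}(N_i)$ for $t\ge T_i$ and $\omega_{\phi_0^{y'}}(N_i)=\sigma(y')$; choose a compact attracting block $W\subset\bigcup_iV_{y_i}$ for $\psi$ with $\omega_\psi(W)=A$ and $W=\mathrm{cl}(\mathrm{int}\,W)$; put $V_i=V_{y_i}\cap\mathrm{int}\,W$ and $K(u)=\mathrm{cl}\big(\bigcup_iN_i\times V_i\big)$. The threshold $\epsilon_1(u)>0$ is such that $K(u)$ is an attracting neighborhood for $\Phi_\epsilon$ for all $0<\epsilon\le\epsilon_1(u)$. Generated lattice. $\mathcal K(\mathcal L)$ is the smallest sublattice of $\mathsf{SANbhd}(\Phi_0)$ containing $\{K(u)\mid u\in\mathcal L\}$, described explicitly as $\big\{\bigcup_{j=1}^m\bigcap_{u\in I_j}K(u)\mid m\ge1,\ I_j\subset\mathcal L\text{ finite}\big\}\cup\{\emptyset\}$. *)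

theory Defs
  imports "HOL-Analysis.Analysis"
begin

section \<open>Bounded distributive lattices on a carrier set\<close>

locale bounded_distributive_lattice =
  fixes L :: "'a set"
    and meet :: "'a \<Rightarrow> 'a \<Rightarrow> 'a"
    and join :: "'a \<Rightarrow> 'a \<Rightarrow> 'a"
    and zero :: 'a
    and unit :: 'a
  assumes zero_closed: "zero \<in> L"
    and unit_closed: "unit \<in> L"
    and meet_closed: "\<lbrakk>a \<in> L; b \<in> L\<rbrakk> \<Longrightarrow> meet a b \<in> L"
    and join_closed: "\<lbrakk>a \<in> L; b \<in> L\<rbrakk> \<Longrightarrow> join a b \<in> L"
    and meet_comm: "\<lbrakk>a \<in> L; b \<in> L\<rbrakk> \<Longrightarrow> meet a b = meet b a"
    and join_comm: "\<lbrakk>a \<in> L; b \<in> L\<rbrakk> \<Longrightarrow> join a b = join b a"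
    and meet_assoc: "\<lbrakk>a \<in> L; b \<in> L; c \<in> L\<rbrakk> \<Longrightarrow> meet (meet a b) c = meet a (meet b c)"
    and join_assoc: "\<lbrakk>a \<in> L; b \<in> L; c \<in> L\<rbrakk> \<Longrightarrow> join (join a b) c = join a (join b c)"
    and meet_absorb: "\<lbrakk>a \<in> L; b \<in> L\<rbrakk> \<Longrightarrow> meet a (join a b) = a"
    and join_absorb: "\<lbrakk>a \<in> L; b \<in> L\<rbrakk> \<Longrightarrow> join a (meet a b) = a"
    and meet_join_distrib:
      "\<lbrakk>a \<in> L; b \<in> L; c \<in> L\<rbrakk> \<Longrightarrow> meet a (join b c) = join (meet a b) (meet a c)"
    and join_zero: "a \<in> L \<Longrightarrow> join a zero = a"
    and meet_unit: "a \<in> L \<Longrightarrow> meet a unit = a"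

locale bounded_lattice_hom =
  dom: bounded_distributive_lattice L meet join zero unit +
  cod: bounded_distributive_lattice L' meet' join' zero' unit'
  for L :: "'a set" and meet join zero unit
    and L' :: "'b set" and meet' join' zero' unit' +
  fixes h :: "'a \<Rightarrow> 'b"
  assumes hom_closed: "a \<in> L \<Longrightarrow> h a \<in> L'"
    and hom_meet: "\<lbrakk>a \<in> L; b \<in> L\<rbrakk> \<Longrightarrow> h (meet a b) = meet' (h a) (h b)"
    and hom_join: "\<lbrakk>a \<in> L; b \<in> L\<rbrakk> \<Longrightarrow> h (join a b) = join' (h a) (h b)"
    and hom_zero: "h zero = zero'"
    and hom_unit: "h unit = unit'"

locale bounded_sublattice =
  bounded_distributive_lattice L meet join zero unit
  for L :: "'a set" and meet join zero unit +
  fixes S :: "'a set"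
  assumes sub: "S \<subseteq> L"
    and sub_zero: "zero \<in> S"
    and sub_unit: "unit \<in> S"
    and sub_meet: "\<lbrakk>a \<in> S; b \<in> S\<rbrakk> \<Longrightarrow> meet a b \<in> S"
    and sub_join: "\<lbrakk>a \<in> S; b \<in> S\<rbrakk> \<Longrightarrow> join a b \<in> S"

lemma (in bounded_sublattice) sublattice_distributive:
  "bounded_distributive_lattice S meet join zero unit"
proof unfold_locales
  show "zero \<in> S" "unit \<in> S" by (rule sub_zero sub_unit)+
next
  fix a b assume "a \<in> S" "b \<in> S"
  then show "meet a b \<in> S" "join a b \<in> S" by (rule sub_meet sub_join; assumption)+
next
  fix a b assume "a \<in> S" "b \<in> S"
  then have "a \<in> L" "b \<in> L" using sub by auto
  then show "meet a b = meet b a" "join a b = join b a"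
    "meet a (join a b) = a" "join a (meet a b) = a"
    by (rule meet_comm join_comm meet_absorb join_absorb; assumption)+
next
  fix a b c assume "a \<in> S" "b \<in> S" "c \<in> S"
  then have "a \<in> L" "b \<in> L" "c \<in> L" using sub by auto
  then show "meet (meet a b) c = meet a (meet b c)" "join (join a b) c = join a (join b c)"
    "meet a (join b c) = join (meet a b) (meet a c)"
    by (rule meet_assoc join_assoc meet_join_distrib; assumption)+
next
  fix a assume "a \<in> S"
  then have "a \<in> L" using sub by auto
  then show "join a zero = a" "meet a unit = a" by (rule join_zero meet_unit; assumption)+
qed

section \<open>Semiflows and attractors\<close>

text \<open>A semiflow is a map \<open>real \<Rightarrow> 'z \<Rightarrow> 'z\<close> of which only the times \<open>t \<ge> 0\<close> are used. The
  phase space is the whole type; its compactness is a separate hypothesis.\<close>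

definition semiflow :: "(real \<Rightarrow> 'z::metric_space \<Rightarrow> 'z) \<Rightarrow> bool" where
  "semiflow \<theta> \<longleftrightarrow>
     continuous_on ({0..} \<times> UNIV) (\<lambda>(t, z). \<theta> t z) \<and>
     (\<forall>z. \<theta> 0 z = z) \<and>
     (\<forall>s\<ge>0. \<forall>t\<ge>0. \<forall>z. \<theta> (s + t) z = \<theta> s (\<theta> t z))"

definition invariant_set :: "(real \<Rightarrow> 'z \<Rightarrow> 'z) \<Rightarrow> 'z set \<Rightarrow> bool" where
  "invariant_set \<theta> S \<longleftrightarrow> (\<forall>t\<ge>0. \<theta> t ` S = S)"

definition Inv :: "'z set \<Rightarrow> (real \<Rightarrow> 'z \<Rightarrow> 'z) \<Rightarrow> 'z set" where
  "Inv U \<theta> = \<Union>{S. S \<subseteq> U \<and> invariant_set \<theta> S}"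

definition omega_limit :: "(real \<Rightarrow> 'z::metric_space \<Rightarrow> 'z) \<Rightarrow> 'z set \<Rightarrow> 'z set" where
  "omega_limit \<theta> U = (\<Inter>t\<in>{0..}. closure (\<Union>s\<in>{t..}. \<theta> s ` U))"

definition attracting_nbhd :: "(real \<Rightarrow> 'z::metric_space \<Rightarrow> 'z) \<Rightarrow> 'z set \<Rightarrow> bool" where
  "attracting_nbhd \<theta> U \<longleftrightarrow> (\<exists>\<tau>>0. \<forall>t\<ge>\<tau>. \<theta> t ` closure U \<subseteq> interior U)"

definition attracting_block :: "(real \<Rightarrow> 'z::metric_space \<Rightarrow> 'z) \<Rightarrow> 'z set \<Rightarrow> bool" where
  "attracting_block \<theta> U \<longleftrightarrow> (\<forall>t>0. \<theta> t ` closure U \<subseteq> interior U)"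

definition Att :: "(real \<Rightarrow> 'z::metric_space \<Rightarrow> 'z) \<Rightarrow> 'z set set" where
  "Att \<theta> = {omega_limit \<theta> U |U. attracting_nbhd \<theta> U}"

definition att_meet :: "(real \<Rightarrow> 'z::metric_space \<Rightarrow> 'z) \<Rightarrow> 'z set \<Rightarrow> 'z set \<Rightarrow> 'z set" where
  "att_meet \<theta> A B = omega_limit \<theta> (A \<inter> B)"

section \<open>Fast-slow skew products\<close>

text \<open>\<open>\<phi> \<epsilon> t x y\<close> is the fast component and \<open>\<psi>\<close> the slow flow before rescaling of time.\<close>

definition skew ::
  "(real \<Rightarrow> real \<Rightarrow> 'x \<Rightarrow> 'y \<Rightarrow> 'x) \<Rightarrow> (real \<Rightarrow> 'y \<Rightarrow> 'y) \<Rightarrow> real \<Rightarrow> real \<Rightarrow> 'x \<times> 'y \<Rightarrow> 'x \<times> 'y" where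
  "skew \<phi> \<psi> \<epsilon> t = (\<lambda>(x, y). (\<phi> \<epsilon> t x y, \<psi> (\<epsilon> * t) y))"

definition fibre_flow ::
  "(real \<Rightarrow> real \<Rightarrow> 'x \<Rightarrow> 'y \<Rightarrow> 'x) \<Rightarrow> 'y \<Rightarrow> real \<Rightarrow> 'x \<Rightarrow> 'x" where
  "fibre_flow \<phi> y = (\<lambda>t x. \<phi> 0 t x y)"

text \<open>On compact metric spaces the differential equations have no literal meaning; only the
  (semi)flows they generate enter. The last clause follows from the time change
  \<open>t \<mapsto> \<epsilon> t\<close> and is recorded as a standing fact.\<close>

definition fast_slow ::
  "(real \<Rightarrow> real \<Rightarrow> 'x::metric_space \<Rightarrow> 'y::metric_space \<Rightarrow> 'x)
    \<Rightarrow> (real \<Rightarrow> 'y \<Rightarrow> 'y) \<Rightarrow> bool" where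
  "fast_slow \<phi> \<psi> \<longleftrightarrow>
     compact (UNIV :: 'x set) \<and> compact (UNIV :: 'y set) \<and>
     semiflow \<psi> \<and>
     (\<forall>\<epsilon>\<ge>0. semiflow (skew \<phi> \<psi> \<epsilon>)) \<and>
     (\<forall>C. compact C \<and> C \<subseteq> {0..} \<times> UNIV \<longrightarrow>
        uniform_limit C (\<lambda>\<epsilon> (t, z). skew \<phi> \<psi> \<epsilon> t z) (\<lambda>(t, z). skew \<phi> \<psi> 0 t z) (at_right 0)) \<and>
     (\<forall>\<epsilon>>0. Att (\<lambda>t. \<psi> (\<epsilon> * t)) = Att \<psi>)"

section \<open>Sections, germs and the cascade\<close>

definition is_section ::
  "(real \<Rightarrow> real \<Rightarrow> 'x::metric_space \<Rightarrow> 'y::metric_space \<Rightarrow> 'x) \<Rightarrow> 'y set \<Rightarrow> ('y \<Rightarrow> 'x set) \<Rightarrow> bool" where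
  "is_section \<phi> U \<sigma> \<longleftrightarrow>
     (\<forall>y\<in>U. \<sigma> y \<in> Att (fibre_flow \<phi> y)) \<and>
     (\<forall>y\<in>U. \<exists>V N. open V \<and> y \<in> V \<and> V \<subseteq> U \<and>
        (\<forall>y'\<in>V. attracting_nbhd (fibre_flow \<phi> y') N \<and> omega_limit (fibre_flow \<phi> y') N = \<sigma> y'))"

definition sections_near ::
  "(real \<Rightarrow> real \<Rightarrow> 'x::metric_space \<Rightarrow> 'y::metric_space \<Rightarrow> 'x) \<Rightarrow> (real \<Rightarrow> 'y \<Rightarrow> 'y) \<Rightarrow> 'y set
    \<Rightarrow> ('y set \<times> ('y \<Rightarrow> 'x set)) set" where
  "sections_near \<phi> \<psi> A =
     {(U, \<sigma>). open U \<and> A \<subseteq> U \<and> omega_limit \<psi> U = A \<and> is_section \<phi> U \<sigma>}"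

text \<open>The germ at \<open>A\<close> of the section \<open>\<sigma>\<close> over \<open>U\<close> is its equivalence class. Sections are total
  functions whose values off their domain \<open>U\<close> are irrelevant; passing to the class removes
  this ambiguity.\<close>

definition germ ::
  "(real \<Rightarrow> real \<Rightarrow> 'x::metric_space \<Rightarrow> 'y::metric_space \<Rightarrow> 'x) \<Rightarrow> (real \<Rightarrow> 'y \<Rightarrow> 'y) \<Rightarrow> 'y set
    \<Rightarrow> 'y set \<Rightarrow> ('y \<Rightarrow> 'x set) \<Rightarrow> ('y set \<times> ('y \<Rightarrow> 'x set)) set" where
  "germ \<phi> \<psi> A U \<sigma> =
     {(U', \<sigma>') \<in> sections_near \<phi> \<psi> A.
        \<exists>V. open V \<and> attracting_nbhd \<psi> V \<and> omega_limit \<psi> V = A \<and> V \<subseteq> U \<inter> U' \<and>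
            (\<forall>y\<in>V. \<sigma> y = \<sigma>' y)}"

type_synonym ('x, 'y) cascade_elem = "'y set \<times> ('y set \<times> ('y \<Rightarrow> 'x set)) set"

definition cascade ::
  "(real \<Rightarrow> real \<Rightarrow> 'x::metric_space \<Rightarrow> 'y::metric_space \<Rightarrow> 'x) \<Rightarrow> (real \<Rightarrow> 'y \<Rightarrow> 'y)
    \<Rightarrow> ('x, 'y) cascade_elem set" where
  "cascade \<phi> \<psi> =
     {(A, germ \<phi> \<psi> A U \<sigma>) |A U \<sigma>. A \<in> Att \<psi> \<and> (U, \<sigma>) \<in> sections_near \<phi> \<psi> A}"

text \<open>The germ of the pointwise meet does not depend on the chosen representatives, so the union
  over all pairs of representatives is the common value.\<close>

definition cascade_meet ::
  "(real \<Rightarrow> real \<Rightarrow> 'x::metric_space \<Rightarrow> 'y::metric_space \<Rightarrow> 'x) \<Rightarrow> (real \<Rightarrow> 'y \<Rightarrow> 'y)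
    \<Rightarrow> ('x, 'y) cascade_elem \<Rightarrow> ('x, 'y) cascade_elem \<Rightarrow> ('x, 'y) cascade_elem" where
  "cascade_meet \<phi> \<psi> u v =
     (fst u \<inter> fst v,
      \<Union>{germ \<phi> \<psi> (fst u \<inter> fst v) (U \<inter> V) (\<lambda>y. att_meet (fibre_flow \<phi> y) (\<sigma> y) (\<tau> y))
        |U \<sigma> V \<tau>. (U, \<sigma>) \<in> snd u \<and> (V, \<tau>) \<in> snd v})"

definition sub_meet_semilattice ::
  "(real \<Rightarrow> real \<Rightarrow> 'x::metric_space \<Rightarrow> 'y::metric_space \<Rightarrow> 'x) \<Rightarrow> (real \<Rightarrow> 'y \<Rightarrow> 'y)
    \<Rightarrow> ('x, 'y) cascade_elem set \<Rightarrow> bool" where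
  "sub_meet_semilattice \<phi> \<psi> \<L> \<longleftrightarrow>
     \<L> \<noteq> {} \<and> \<L> \<subseteq> cascade \<phi> \<psi> \<and> (\<forall>u\<in>\<L>. \<forall>v\<in>\<L>. cascade_meet \<phi> \<psi> u v \<in> \<L>)"

section \<open>Singular attracting neighborhoods\<close>

definition singular_attracting_nbhd ::
  "(real \<Rightarrow> real \<Rightarrow> 'z::metric_space \<Rightarrow> 'z) \<Rightarrow> 'z set \<Rightarrow> bool" where
  "singular_attracting_nbhd \<Phi> K \<longleftrightarrow>
     \<not> attracting_nbhd (\<Phi> 0) K \<and>
     (\<exists>\<epsilon>\<^sub>K>0. \<forall>\<epsilon>. 0 < \<epsilon> \<and> \<epsilon> \<le> \<epsilon>\<^sub>K \<longrightarrow> attracting_nbhd (\<Phi> \<epsilon>) K)"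

text \<open>The properly singular neighborhoods alone are neither closed under union and intersection
  nor do they include the bounds \<open>{}\<close> and \<open>UNIV\<close>. The bounded distributive lattice they live
  in also has the nonsingular members: those sets which are attracting neighborhoods for
  \<open>\<epsilon> = 0\<close> too. Such sets do occur as \<open>K(u)\<close>: if the slow attractor is empty, then
  \<open>K(u) = {}\<close>, and if it is all of \<open>Y\<close>, then \<open>K(u)\<close> attracts for \<open>\<epsilon> = 0\<close>.\<close>

definition SANbhd :: "(real \<Rightarrow> real \<Rightarrow> 'z::metric_space \<Rightarrow> 'z) \<Rightarrow> 'z set set" where
  "SANbhd \<Phi> =
     {K. singular_attracting_nbhd \<Phi> K} \<union>
     {K. attracting_nbhd (\<Phi> 0) K \<and>
         (\<exists>\<epsilon>\<^sub>K>0. \<forall>\<epsilon>. 0 < \<epsilon> \<and> \<epsilon> \<le> \<epsilon>\<^sub>K \<longrightarrow> attracting_nbhd (\<Phi> \<epsilon>) K)}"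

definition associated_nbhd ::
  "(real \<Rightarrow> real \<Rightarrow> 'x::metric_space \<Rightarrow> 'y::metric_space \<Rightarrow> 'x) \<Rightarrow> (real \<Rightarrow> 'y \<Rightarrow> 'y)
    \<Rightarrow> ('x, 'y) cascade_elem \<Rightarrow> ('x \<times> 'y) set \<Rightarrow> bool" where
  "associated_nbhd \<phi> \<psi> u K \<longleftrightarrow>
     (\<exists>U \<sigma>. (U, \<sigma>) \<in> snd u \<and>
       (\<exists>(n::nat) y V N T W.
          (\<forall>i<n. y i \<in> fst u \<and> open (V i) \<and> y i \<in> V i \<and> closure (V i) \<subseteq> U \<and>
             compact (N i) \<and> T i > 0 \<and>
             (\<forall>y'\<in>closure (V i).
                (\<forall>t\<ge>T i. fibre_flow \<phi> y' t ` N i \<subseteq> interior (N i)) \<and>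
                omega_limit (fibre_flow \<phi> y') (N i) = \<sigma> y')) \<and>
          fst u \<subseteq> (\<Union>i<n. V i) \<and>
          compact W \<and> attracting_block \<psi> W \<and> W \<subseteq> (\<Union>i<n. V i) \<and>
          omega_limit \<psi> W = fst u \<and> W = closure (interior W) \<and>
          K = closure (\<Union>i<n. N i \<times> (V i \<inter> interior W))))"

definition attracting_threshold ::
  "(real \<Rightarrow> real \<Rightarrow> 'z::metric_space \<Rightarrow> 'z) \<Rightarrow> 'z set \<Rightarrow> real \<Rightarrow> bool" where
  "attracting_threshold \<Phi> K \<epsilon>\<^sub>1 \<longleftrightarrow>
     \<epsilon>\<^sub>1 > 0 \<and> (\<forall>\<epsilon>. 0 < \<epsilon> \<and> \<epsilon> \<le> \<epsilon>\<^sub>1 \<longrightarrow> attracting_nbhd (\<Phi> \<epsilon>) K)"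

text \<open>The empty index set is allowed and contributes the top element \<open>UNIV\<close>.\<close>

definition generated_lattice :: "('u \<Rightarrow> 'z set) \<Rightarrow> 'u set \<Rightarrow> 'z set set" where
  "generated_lattice K \<L> =
     {(\<Union>j<m. \<Inter>u\<in>I j. K u) |(m::nat) I. m \<ge> 1 \<and> (\<forall>j<m. I j \<subseteq> \<L> \<and> finite (I j))} \<union> {{}}"

lemma attracting_nbhd_Int:
  assumes "attracting_nbhd \<theta> U" "attracting_nbhd \<theta> V"
  shows "attracting_nbhd \<theta> (U \<inter> V)"
proof -
  obtain s where s: "s > 0" "\<forall>t\<ge>s. \<theta> t ` closure U \<subseteq> interior U"
    using assms(1) by (auto simp: attracting_nbhd_def)
  obtain r where r: "r > 0" "\<forall>t\<ge>r. \<theta> t ` closure V \<subseteq> interior V"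
    using assms(2) by (auto simp: attracting_nbhd_def)
  have "\<theta> t ` closure (U \<inter> V) \<subseteq> interior (U \<inter> V)" if "t \<ge> max s r" for t
  proof -
    have "\<theta> t ` closure U \<subseteq> interior U" "\<theta> t ` closure V \<subseteq> interior V"
      using s r that by auto
    moreover have "closure (U \<inter> V) \<subseteq> closure U" "closure (U \<inter> V) \<subseteq> closure V"
      by (simp_all add: closure_mono)
    ultimately show ?thesis by (simp add: interior_Int) blast
  qed
  then show ?thesis using s(1) unfolding attracting_nbhd_def
    by (intro exI[of _ "max s r"]) auto
qed

lemma attracting_nbhd_Un:
  assumes "attracting_nbhd \<theta> U" "attracting_nbhd \<theta> V"
  shows "attracting_nbhd \<theta> (U \<union> V)"
proof -
  obtain s where s: "s > 0" "\<forall>t\<ge>s. \<theta> t ` closure U \<subseteq> interior U"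
    using assms(1) by (auto simp: attracting_nbhd_def)
  obtain r where r: "r > 0" "\<forall>t\<ge>r. \<theta> t ` closure V \<subseteq> interior V"
    using assms(2) by (auto simp: attracting_nbhd_def)
  have "\<theta> t ` closure (U \<union> V) \<subseteq> interior (U \<union> V)" if "t \<ge> max s r" for t
  proof -
    have "\<theta> t ` closure U \<subseteq> interior U" "\<theta> t ` closure V \<subseteq> interior V"
      using s r that by auto
    moreover have "interior U \<subseteq> interior (U \<union> V)" "interior V \<subseteq> interior (U \<union> V)"
      by (auto intro: interior_mono[THEN subsetD])
    ultimately show ?thesis by (simp add: closure_Un image_Un) blast
  qed
  then show ?thesis using s(1) unfolding attracting_nbhd_def
    by (intro exI[of _ "max s r"]) auto
qed

lemma attracting_nbhd_trivial [simp]: "attracting_nbhd \<theta> {}" "attracting_nbhd \<theta> UNIV"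
  by (auto simp: attracting_nbhd_def intro: exI[of _ 1])

lemma SANbhd_iff:
  "K \<in> SANbhd \<Phi> \<longleftrightarrow> (\<exists>e>0. \<forall>\<epsilon>. 0 < \<epsilon> \<and> \<epsilon> \<le> e \<longrightarrow> attracting_nbhd (\<Phi> \<epsilon>) K)"
  unfolding SANbhd_def singular_attracting_nbhd_def by blast

lemma SANbhd_Int_Un:
  assumes "K \<in> SANbhd \<Phi>" "K' \<in> SANbhd \<Phi>"
  shows "K \<inter> K' \<in> SANbhd \<Phi>" "K \<union> K' \<in> SANbhd \<Phi>"
proof -
  obtain e where e: "e > 0" "\<forall>\<epsilon>. 0 < \<epsilon> \<and> \<epsilon> \<le> e \<longrightarrow> attracting_nbhd (\<Phi> \<epsilon>) K"
    using assms(1) unfolding SANbhd_iff by blast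
  obtain e' where e': "e' > 0" "\<forall>\<epsilon>. 0 < \<epsilon> \<and> \<epsilon> \<le> e' \<longrightarrow> attracting_nbhd (\<Phi> \<epsilon>) K'"
    using assms(2) unfolding SANbhd_iff by blast
  show "K \<inter> K' \<in> SANbhd \<Phi>" "K \<union> K' \<in> SANbhd \<Phi>"
    unfolding SANbhd_iff using e e'
    by (intro exI[of _ "min e e'"]; simp add: attracting_nbhd_Int attracting_nbhd_Un)+
qed

lemma SANbhd_bounds: "{} \<in> SANbhd \<Phi>" "UNIV \<in> SANbhd \<Phi>"
  unfolding SANbhd_iff by (auto intro: exI[of _ 1])

lemma SANbhd_lattice: "bounded_distributive_lattice (SANbhd \<Phi>) (\<inter>) (\<union>) {} UNIV"
  by unfold_locales (auto intro: SANbhd_Int_Un SANbhd_bounds)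

lemma generated_lattice_alt:
  "generated_lattice K \<L> =
     {(\<Union>I\<in>F. \<Inter>u\<in>I. K u) |F. finite F \<and> (\<forall>I\<in>F. I \<subseteq> \<L> \<and> finite I)}" (is "_ = ?R")
proof (intro equalityI subsetI)
  fix N assume "N \<in> generated_lattice K \<L>"
  then consider "N = {}"
    | m I where "N = (\<Union>j<m::nat. \<Inter>u\<in>I j. K u)" "\<forall>j<m. I j \<subseteq> \<L> \<and> finite (I j)"
    unfolding generated_lattice_def by blast
  then show "N \<in> ?R"
  proof cases
    case 1
    then show ?thesis by (intro CollectI exI[of _ "{}"]) auto
  next
    case 2
    then show ?thesis by (intro CollectI exI[of _ "I ` {..<m}"]) auto
  qed
next
  fix N assume "N \<in> ?R"
  then obtain F where F: "N = (\<Union>I\<in>F. \<Inter>u\<in>I. K u)" "finite F" "\<forall>I\<in>F. I \<subseteq> \<L> \<and> finite I"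
    by blast
  obtain m and J :: "nat \<Rightarrow> _" where J: "F = J ` {i. i < m}"
    using finite_imp_nat_seg_image_inj_on[OF F(2)] by blast
  show "N \<in> generated_lattice K \<L>"
  proof (cases "m = 0")
    case True
    then show ?thesis using F J by (auto simp: generated_lattice_def)
  next
    case False
    have "N = (\<Union>j<m. \<Inter>u\<in>J j. K u)" "\<forall>j<m. J j \<subseteq> \<L> \<and> finite (J j)"
      using F J by auto
    with False show ?thesis unfolding generated_lattice_def
      by (intro UnI1 CollectI exI[of _ m] exI[of _ J]) auto
  qed
qed

lemma generated_lattice_Un:
  assumes "M \<in> generated_lattice K \<L>" "N \<in> generated_lattice K \<L>"
  shows "M \<union> N \<in> generated_lattice K \<L>"
proof -
  obtain F where F: "M = (\<Union>I\<in>F. \<Inter>u\<in>I. K u)" "finite F" "\<forall>I\<in>F. I \<subseteq> \<L> \<and> finite I"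
    using assms(1) unfolding generated_lattice_alt by blast
  obtain G where G: "N = (\<Union>I\<in>G. \<Inter>u\<in>I. K u)" "finite G" "\<forall>I\<in>G. I \<subseteq> \<L> \<and> finite I"
    using assms(2) unfolding generated_lattice_alt by blast
  show ?thesis unfolding generated_lattice_alt
    by (intro CollectI exI[of _ "F \<union> G"]) (use F G in auto)
qed

lemma generated_lattice_Int:
  assumes "M \<in> generated_lattice K \<L>" "N \<in> generated_lattice K \<L>"
  shows "M \<inter> N \<in> generated_lattice K \<L>"
proof -
  obtain F where F: "M = (\<Union>I\<in>F. \<Inter>u\<in>I. K u)" "finite F" "\<forall>I\<in>F. I \<subseteq> \<L> \<and> finite I"
    using assms(1) unfolding generated_lattice_alt by blast
  obtain G where G: "N = (\<Union>I\<in>G. \<Inter>u\<in>I. K u)" "finite G" "\<forall>I\<in>G. I \<subseteq> \<L> \<and> finite I"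
    using assms(2) unfolding generated_lattice_alt by blast
  let ?H = "(\<lambda>(I, J). I \<union> J) ` (F \<times> G)"
  have "M \<inter> N = (\<Union>I\<in>?H. \<Inter>u\<in>I. K u)"
  proof (intro equalityI subsetI)
    fix z assume "z \<in> M \<inter> N"
    then obtain I J where "I \<in> F" "J \<in> G" "\<forall>u\<in>I. z \<in> K u" "\<forall>u\<in>J. z \<in> K u"
      unfolding F(1) G(1) by blast
    then have "I \<union> J \<in> ?H" "z \<in> (\<Inter>u\<in>I \<union> J. K u)" by auto
    then show "z \<in> (\<Union>I\<in>?H. \<Inter>u\<in>I. K u)" by (rule UN_I)
  next
    fix z assume "z \<in> (\<Union>I\<in>?H. \<Inter>u\<in>I. K u)"
    then obtain I J where "I \<in> F" "J \<in> G" "\<forall>u\<in>I \<union> J. z \<in> K u" by auto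
    then show "z \<in> M \<inter> N" unfolding F(1) G(1) by blast
  qed
  moreover have "finite ?H" "\<forall>I\<in>?H. I \<subseteq> \<L> \<and> finite I"
    using F G by auto
  ultimately show ?thesis unfolding generated_lattice_alt by blast
qed

lemma generated_lattice_bounds: "{} \<in> generated_lattice K \<L>" "UNIV \<in> generated_lattice K \<L>"
proof -
  show "{} \<in> generated_lattice K \<L>" by (simp add: generated_lattice_def)
  show "UNIV \<in> generated_lattice K \<L>" unfolding generated_lattice_alt
    by (intro CollectI exI[of _ "{{}}"]) auto
qed

lemma generated_lattice_generator: "u \<in> \<L> \<Longrightarrow> K u \<in> generated_lattice K \<L>"
  unfolding generated_lattice_alt by (intro CollectI exI[of _ "{{u}}"]) auto

lemma generated_lattice_least:
  assumes "K ` \<L> \<subseteq> S" "{} \<in> S" "UNIV \<in> S"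
    and Int: "\<And>a b. a \<in> S \<Longrightarrow> b \<in> S \<Longrightarrow> a \<inter> b \<in> S"
    and Un: "\<And>a b. a \<in> S \<Longrightarrow> b \<in> S \<Longrightarrow> a \<union> b \<in> S"
  shows "generated_lattice K \<L> \<subseteq> S"
proof
  have I: "(\<Inter>u\<in>I. K u) \<in> S" if "finite I" "I \<subseteq> \<L>" for I
    using that by (induction I) (use assms in auto)
  fix N assume "N \<in> generated_lattice K \<L>"
  then obtain F where F: "N = (\<Union>I\<in>F. \<Inter>u\<in>I. K u)" "finite F" "\<forall>I\<in>F. I \<subseteq> \<L> \<and> finite I"
    unfolding generated_lattice_alt by blast
  from F(2,3) have "(\<Union>I\<in>F. \<Inter>u\<in>I. K u) \<in> S"
    by (induction F) (use assms I in auto)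
  with F(1) show "N \<in> S" by simp
qed

text \<open>The explicit description is the smallest bounded sublattice of \<open>SANbhd \<Phi>\<close> containing the
  generators.\<close>

lemma generated_lattice_sublattice:
  assumes "\<And>u. u \<in> \<L> \<Longrightarrow> K u \<in> SANbhd \<Phi>"
  shows "bounded_sublattice (SANbhd \<Phi>) (\<inter>) (\<union>) {} UNIV (generated_lattice K \<L>)"
proof -
  interpret bounded_distributive_lattice "SANbhd \<Phi>" "(\<inter>)" "(\<union>)" "{}" UNIV
    by (rule SANbhd_lattice)
  have "generated_lattice K \<L> \<subseteq> SANbhd \<Phi>"
    by (rule generated_lattice_least) (use assms in \<open>auto intro: SANbhd_Int_Un SANbhd_bounds\<close>)
  then show ?thesis
    by unfold_locales (auto intro: generated_lattice_Int generated_lattice_Un generated_lattice_bounds)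
qed

lemma generated_lattice_smallest:
  assumes "bounded_sublattice (SANbhd \<Phi>) (\<inter>) (\<union>) {} UNIV S" "K ` \<L> \<subseteq> S"
  shows "generated_lattice K \<L> \<subseteq> S"
proof -
  interpret bounded_sublattice "SANbhd \<Phi>" "(\<inter>)" "(\<union>)" "{}" UNIV S by fact
  show ?thesis
    by (rule generated_lattice_least) (use assms(2) sub_meet sub_join sub_zero sub_unit in auto)
qed

end

theory Submission
  imports Defs
begin

text \<open>
  The problem reduces to one about a single semiflow \<open>\<theta> = skew \<phi> \<psi> \<epsilon>\<close> on the compact space
  \<open>X \<times> Y\<close>: since \<open>\<epsilon>\<close> does not exceed any of the thresholds, every generator \<open>K u\<close> is an
  attracting neighborhood for \<open>\<theta>\<close>. Attracting neighborhoods are closed under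
  \<open>\<inter>\<close> and \<open>\<union>\<close> and include both bounds, so the whole generated lattice consists of them.

  It is then enough that \<open>U \<mapsto> Inv U \<theta>\<close> carries the lattice of attracting neighborhoods onto
  \<open>Att \<theta>\<close>, taking \<open>\<inter>\<close> to the meet of attractors and \<open>\<union>\<close> to \<open>\<union>\<close>. The core is the identity
  \<open>omega_limit \<theta> U = Inv U \<theta>\<close> for an attracting neighborhood \<open>U\<close>
  (\<open>omega_limit_eq_Inv\<close>), which rests on the invariance of omega-limit sets in a compact space.
  Each side of the identity makes one operation transparent: omega-limit sets commute with unions,
  since they are intersections of families that shrink with time, whereas the
  invariant subsets of \<open>U \<inter> V\<close> are exactly those lying in both maximal invariant sets
  \<open>Inv U \<theta>\<close> and \<open>Inv V \<theta>\<close>. The lattice laws of \<open>Att \<theta>\<close> are inherited through this surjection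
  from those of sets, and the image of the generated lattice is finite because a lattice
  generated by finitely many sets is finite.
\<close>

section \<open>Images of bounded distributive lattices\<close>

text \<open>The laws are equations, so they pass to any image under a map respecting the operations; this
  spares a direct verification of associativity and distributivity for the meet of attractors.\<close>

lemma bounded_distributive_lattice_image:
  assumes "bounded_distributive_lattice L meet join zero unit"
    and meet: "\<And>a b. a \<in> L \<Longrightarrow> b \<in> L \<Longrightarrow> h (meet a b) = meet' (h a) (h b)"
    and join: "\<And>a b. a \<in> L \<Longrightarrow> b \<in> L \<Longrightarrow> h (join a b) = join' (h a) (h b)"
  shows "bounded_distributive_lattice (h ` L) meet' join' (h zero) (h unit)"
proof -
  interpret bounded_distributive_lattice L meet join zero unit by fact
  note closed = meet_closed join_closed zero_closed unit_closed
  show ?thesis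
    by unfold_locales
      (auto simp: meet[symmetric] join[symmetric] closed meet_absorb join_absorb join_zero
        meet_unit meet_join_distrib meet_assoc join_assoc
        intro!: arg_cong[where f = h] meet_comm join_comm)
qed

section \<open>Omega-limit sets and maximal invariant sets\<close>

lemma omega_limit_mono: "U \<subseteq> V \<Longrightarrow> omega_limit \<theta> U \<subseteq> omega_limit \<theta> V"
  unfolding omega_limit_def by (intro INF_mono' closure_mono UN_mono image_mono) auto

text \<open>A point outside both limit sets leaves the tail closure of \<open>U\<close> at some time \<open>s\<close> and that of
  \<open>V\<close> at some time \<open>t\<close>, hence that of \<open>U \<union> V\<close> at \<open>max s t\<close>.\<close>

lemma omega_limit_Un: "omega_limit \<theta> (U \<union> V) = omega_limit \<theta> U \<union> omega_limit \<theta> V"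
proof
  let ?C = "\<lambda>W t. closure (\<Union>s\<in>{t..}. \<theta> s ` W)"
  show "omega_limit \<theta> (U \<union> V) \<subseteq> omega_limit \<theta> U \<union> omega_limit \<theta> V"
  proof
    fix z assume z: "z \<in> omega_limit \<theta> (U \<union> V)"
    show "z \<in> omega_limit \<theta> U \<union> omega_limit \<theta> V"
    proof (rule ccontr)
      assume "z \<notin> omega_limit \<theta> U \<union> omega_limit \<theta> V"
      then obtain s t where st: "s \<ge> 0" "t \<ge> 0" "z \<notin> ?C U s" "z \<notin> ?C V t"
        unfolding omega_limit_def by auto
      have "z \<in> ?C (U \<union> V) (max s t)"
        using z st unfolding omega_limit_def by auto
      also have "\<dots> = ?C U (max s t) \<union> ?C V (max s t)"
        by (simp add: image_Un UN_Un_distrib)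
      also have "\<dots> \<subseteq> ?C U s \<union> ?C V t"
        by (intro Un_mono closure_mono UN_mono) auto
      finally show False using st by blast
    qed
  qed
qed (simp add: omega_limit_mono)

lemma invariant_set_subset_omega_limit:
  assumes "invariant_set \<theta> S" "S \<subseteq> U"
  shows "S \<subseteq> omega_limit \<theta> U"
  unfolding omega_limit_def
proof (rule INT_greatest)
  fix t :: real assume "t \<in> {0..}"
  then have "S = \<theta> t ` S" using assms(1) by (simp add: invariant_set_def)
  also have "\<dots> \<subseteq> (\<Union>s\<in>{t..}. \<theta> s ` U)" using assms(2) by auto
  also have "\<dots> \<subseteq> closure \<dots>" by (rule closure_subset)
  finally show "S \<subseteq> closure (\<Union>s\<in>{t..}. \<theta> s ` U)" .
qed

lemma Inv_subset: "Inv U \<theta> \<subseteq> U"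
  unfolding Inv_def by blast

lemma semiflow_continuous:
  assumes "semiflow \<theta>" "t \<ge> 0"
  shows "continuous_on A (\<theta> t)"
proof -
  have "continuous_on ({0..} \<times> UNIV) (\<lambda>(t, z). \<theta> t z)"
    using assms(1) by (simp add: semiflow_def)
  then have "continuous_on A ((\<lambda>(t, z). \<theta> t z) \<circ> Pair t)"
    by (intro continuous_on_compose continuous_intros) (auto elim: continuous_on_subset simp: assms(2))
  then show ?thesis by (simp add: o_def)
qed

text \<open>For the inclusion of the limit set in its own image, compactness is needed twice: it makes the
  image of a tail closure closed, so that a limit point has a preimage in every tail closure, and it
  gives these nested sets of preimages a common point.\<close>

lemma invariant_set_omega_limit:
  fixes \<theta> :: "real \<Rightarrow> 'z::metric_space \<Rightarrow> 'z"
  assumes flow: "semiflow \<theta>" and cpt: "compact (UNIV :: 'z set)"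
  shows "invariant_set \<theta> (omega_limit \<theta> U)"
  unfolding invariant_set_def
proof (intro allI impI)
  fix t :: real assume t: "t \<ge> 0"
  define G where "G = (\<lambda>r. \<Union>s\<in>{r..}. \<theta> s ` U)"
  define C where "C = (\<lambda>r. closure (G r))"
  have omega: "omega_limit \<theta> U = (\<Inter>r\<in>{0..}. C r)"
    by (simp add: omega_limit_def C_def G_def)
  have anti: "C s \<subseteq> C r" if "r \<le> s" for r s
    unfolding C_def G_def using that by (intro closure_mono UN_mono) auto
  have cont: "continuous_on A (\<theta> t)" for A
    using flow t by (rule semiflow_continuous)
  have add: "\<theta> (t + s) z = \<theta> t (\<theta> s z)" if "s \<ge> 0" for s z
    using flow t that by (simp add: semiflow_def)
  have shift: "\<theta> t ` G r = G (r + t)" if "r \<ge> 0" for r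
  proof
    show "\<theta> t ` G r \<subseteq> G (r + t)"
      using that t by (force simp: G_def add[symmetric])
    show "G (r + t) \<subseteq> \<theta> t ` G r"
    proof
      fix z assume "z \<in> G (r + t)"
      then obtain s x where s: "s \<ge> r + t" "x \<in> U" "z = \<theta> s x" by (auto simp: G_def)
      then have "z = \<theta> t (\<theta> (s - t) x)" using add[of "s - t" x] that by simp
      moreover have "\<theta> (s - t) x \<in> G r" using s by (auto simp: G_def)
      ultimately show "z \<in> \<theta> t ` G r" by blast
    qed
  qed
  show "\<theta> t ` omega_limit \<theta> U = omega_limit \<theta> U"
  proof
    show "\<theta> t ` omega_limit \<theta> U \<subseteq> omega_limit \<theta> U"
    proof -
      have "\<theta> t ` C r \<subseteq> C r" if "r \<ge> 0" for r
      proof -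
        have "\<theta> t ` C r \<subseteq> C (r + t)"
          unfolding C_def shift[OF that, symmetric]
          by (intro image_closure_subset[OF cont] closed_closure closure_subset)
        also have "\<dots> \<subseteq> C r" using t by (intro anti) simp
        finally show ?thesis .
      qed
      then show ?thesis unfolding omega by fastforce
    qed
    show "omega_limit \<theta> U \<subseteq> \<theta> t ` omega_limit \<theta> U"
    proof
      fix z assume z: "z \<in> omega_limit \<theta> U"
      define P where "P = (\<lambda>r. C r \<inter> \<theta> t -` {z})"
      have closed_P: "closed (P r)" for r
        unfolding P_def C_def
        by (intro closed_Int closed_closure continuous_closed_vimage)
           (use cont[of UNIV] in \<open>auto simp: continuous_on_eq_continuous_at\<close>)
      have P_nonempty: "P r \<noteq> {}" if r: "r \<ge> 0" for r
      proof -
        have "compact (C r)"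
          using closed_Int_compact[OF closed_closure cpt] by (simp add: C_def)
        then have closed: "closed (\<theta> t ` C r)"
          by (intro compact_imp_closed compact_continuous_image[OF cont])
        have "z \<in> C (r + t)" using z r t unfolding omega by auto
        also have "\<dots> \<subseteq> \<theta> t ` C r"
        proof -
          have "G r \<subseteq> C r" by (simp add: C_def closure_subset)
          then have "closure (\<theta> t ` G r) \<subseteq> \<theta> t ` C r"
            by (intro closure_minimal closed image_mono)
          then show ?thesis by (simp add: C_def shift[OF r])
        qed
        finally show ?thesis unfolding P_def by blast
      qed
      have "UNIV \<inter> (\<Inter>r\<in>{0..}. P r) \<noteq> {}"
      proof (rule compact_imp_fip_image[OF cpt])
        fix I :: "real set" assume I: "finite I" "I \<subseteq> {0..}"
        \<comment> \<open>The extra index \<open>0\<close> covers the case of an empty subfamily.\<close>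
        define m where "m = Max (insert 0 I)"
        have "m \<ge> 0" "\<forall>r\<in>I. r \<le> m" using I(1) by (auto simp: m_def)
        then have "P m \<noteq> {}" "P m \<subseteq> (\<Inter>r\<in>I. P r)"
          using P_nonempty anti by (blast, force simp: P_def)
        then show "UNIV \<inter> (\<Inter>r\<in>I. P r) \<noteq> {}" by blast
      qed (rule closed_P)
      then obtain x where "x \<in> (\<Inter>r\<in>{0..}. P r)" by blast
      then have "x \<in> omega_limit \<theta> U" "\<theta> t x = z"
        unfolding omega P_def by auto
      then show "z \<in> \<theta> t ` omega_limit \<theta> U" by blast
    qed
  qed
qed

text \<open>The limit set lies a priori only in \<open>closure U\<close>. Being invariant, it equals its own image
  under a late time map, and that map sends \<open>closure U\<close> into \<open>U\<close>.\<close>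

lemma omega_limit_eq_Inv:
  fixes \<theta> :: "real \<Rightarrow> 'z::metric_space \<Rightarrow> 'z"
  assumes "semiflow \<theta>" "compact (UNIV :: 'z set)" and U: "attracting_nbhd \<theta> U"
  shows "omega_limit \<theta> U = Inv U \<theta>"
proof
  show "Inv U \<theta> \<subseteq> omega_limit \<theta> U"
    unfolding Inv_def using invariant_set_subset_omega_limit by (metis (mono_tags) Sup_least mem_Collect_eq)
  obtain \<tau> where \<tau>: "\<tau> > 0" "\<And>t. t \<ge> \<tau> \<Longrightarrow> \<theta> t ` closure U \<subseteq> interior U"
    using U by (auto simp: attracting_nbhd_def)
  have inv: "invariant_set \<theta> (omega_limit \<theta> U)"
    using assms(1,2) by (rule invariant_set_omega_limit)
  have "(\<Union>s\<in>{\<tau>..}. \<theta> s ` U) \<subseteq> U"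
    using \<tau>(2) closure_subset[of U] interior_subset[of U] by fastforce
  then have "closure (\<Union>s\<in>{\<tau>..}. \<theta> s ` U) \<subseteq> closure U"
    by (rule closure_mono)
  then have "omega_limit \<theta> U \<subseteq> closure U"
    using \<tau>(1) unfolding omega_limit_def by (intro INF_lower2[of \<tau>]) auto
  moreover have "omega_limit \<theta> U = \<theta> \<tau> ` omega_limit \<theta> U"
    using inv \<tau>(1) by (simp add: invariant_set_def)
  ultimately have "omega_limit \<theta> U \<subseteq> U"
    using \<tau>(2)[of \<tau>] interior_subset[of U] by blast
  then show "omega_limit \<theta> U \<subseteq> Inv U \<theta>"
    using inv unfolding Inv_def by blast
qed

section \<open>From attracting neighborhoods to attractors\<close>

lemma attracting_nbhd_lattice:
  "bounded_distributive_lattice {U. attracting_nbhd \<theta> U} (\<inter>) (\<union>) {} UNIV"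
  by unfold_locales (auto intro: attracting_nbhd_Int attracting_nbhd_Un)

context
  fixes \<theta> :: "real \<Rightarrow> 'z::metric_space \<Rightarrow> 'z"
  assumes flow: "semiflow \<theta>" and cpt: "compact (UNIV :: 'z set)"
begin

lemma Att_eq_image_Inv: "Att \<theta> = (\<lambda>U. Inv U \<theta>) ` {U. attracting_nbhd \<theta> U}"
  unfolding Att_def using omega_limit_eq_Inv[OF flow cpt] by auto

lemma Inv_Un:
  assumes "attracting_nbhd \<theta> U" "attracting_nbhd \<theta> V"
  shows "Inv (U \<union> V) \<theta> = Inv U \<theta> \<union> Inv V \<theta>"
  using omega_limit_Un[of \<theta> U V] assms
  by (simp add: omega_limit_eq_Inv[OF flow cpt] attracting_nbhd_Un)

text \<open>The attractors \<open>A \<subseteq> U\<close> and \<open>B \<subseteq> V\<close> have an intersection that need not be invariant. Every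
  invariant subset of \<open>U \<inter> V\<close> lies in \<open>A \<inter> B\<close> and so survives in its omega-limit set, which in turn
  cannot exceed that of \<open>U \<inter> V\<close>.\<close>

lemma Inv_Int:
  assumes U: "attracting_nbhd \<theta> U" and V: "attracting_nbhd \<theta> V"
  shows "Inv (U \<inter> V) \<theta> = att_meet \<theta> (Inv U \<theta>) (Inv V \<theta>)"
  unfolding att_meet_def
proof
  show "Inv (U \<inter> V) \<theta> \<subseteq> omega_limit \<theta> (Inv U \<theta> \<inter> Inv V \<theta>)"
  proof
    fix z assume "z \<in> Inv (U \<inter> V) \<theta>"
    then obtain S where S: "z \<in> S" "S \<subseteq> U \<inter> V" "invariant_set \<theta> S"
      unfolding Inv_def by blast
    then have "S \<subseteq> Inv U \<theta> \<inter> Inv V \<theta>" unfolding Inv_def by blast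
    with S show "z \<in> omega_limit \<theta> (Inv U \<theta> \<inter> Inv V \<theta>)"
      using invariant_set_subset_omega_limit by blast
  qed
  have "omega_limit \<theta> (Inv U \<theta> \<inter> Inv V \<theta>) \<subseteq> omega_limit \<theta> (U \<inter> V)"
    by (intro omega_limit_mono Int_mono Inv_subset)
  then show "omega_limit \<theta> (Inv U \<theta> \<inter> Inv V \<theta>) \<subseteq> Inv (U \<inter> V) \<theta>"
    by (simp add: omega_limit_eq_Inv[OF flow cpt] attracting_nbhd_Int U V)
qed

lemma Inv_empty: "Inv {} \<theta> = {}"
  using Inv_subset[of "{}" \<theta>] by simp

lemma Inv_UNIV: "Inv UNIV \<theta> = omega_limit \<theta> UNIV"
  by (simp add: omega_limit_eq_Inv[OF flow cpt])

lemma Att_lattice: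
  "bounded_distributive_lattice (Att \<theta>) (att_meet \<theta>) (\<union>) {} (omega_limit \<theta> UNIV)"
proof -
  have "bounded_distributive_lattice ((\<lambda>U. Inv U \<theta>) ` {U. attracting_nbhd \<theta> U})
          (att_meet \<theta>) (\<union>) (Inv {} \<theta>) (Inv UNIV \<theta>)"
    by (rule bounded_distributive_lattice_image[OF attracting_nbhd_lattice])
      (simp_all add: Inv_Int Inv_Un)
  then show ?thesis by (simp add: Att_eq_image_Inv Inv_empty Inv_UNIV)
qed

lemma Inv_lattice_hom:
  assumes "bounded_sublattice {U. attracting_nbhd \<theta> U} (\<inter>) (\<union>) {} UNIV S"
  shows "bounded_lattice_hom S (\<inter>) (\<union>) {} UNIV
           (Att \<theta>) (att_meet \<theta>) (\<union>) {} (omega_limit \<theta> UNIV) (\<lambda>N. Inv N \<theta>)"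
proof -
  interpret bounded_sublattice "{U. attracting_nbhd \<theta> U}" "(\<inter>)" "(\<union>)" "{}" UNIV S by fact
  have S: "attracting_nbhd \<theta> U" if "U \<in> S" for U using sub that by blast
  show ?thesis
    by (intro bounded_lattice_hom.intro bounded_lattice_hom_axioms.intro
        sublattice_distributive Att_lattice)
      (auto simp: Inv_Int Inv_Un Inv_empty Inv_UNIV S Att_eq_image_Inv)
qed

end

lemma bounded_lattice_hom_image_sublattice:
  assumes "bounded_lattice_hom L meet join zero unit L' meet' join' zero' unit' h"
  shows "bounded_sublattice L' meet' join' zero' unit' (h ` L)"
proof -
  interpret bounded_lattice_hom L meet join zero unit L' meet' join' zero' unit' h by fact
  show ?thesis
  proof unfold_locales
    show "h ` L \<subseteq> L'" using hom_closed by blast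
    show "zero' \<in> h ` L" "unit' \<in> h ` L"
      using hom_zero hom_unit dom.zero_closed dom.unit_closed by (metis imageI)+
    show "meet' a b \<in> h ` L" "join' a b \<in> h ` L" if "a \<in> h ` L" "b \<in> h ` L" for a b
      using that by (auto simp: hom_meet[symmetric] hom_join[symmetric]
          dom.meet_closed dom.join_closed)
  qed
qed

section \<open>The generated lattice\<close>

text \<open>By distributivity a lattice term is determined by a set of subsets of the generators.\<close>

lemma finite_generated_lattice:
  assumes "finite \<L>"
  shows "finite (generated_lattice K \<L>)"
proof (rule finite_surj)
  show "finite (Pow (Pow \<L>))" using assms by simp
  show "generated_lattice K \<L> \<subseteq> (\<lambda>F. \<Union>I\<in>F. \<Inter>u\<in>I. K u) ` Pow (Pow \<L>)"
    unfolding generated_lattice_alt by auto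
qed

lemma generated_lattice_attracting_sublattice:
  assumes "\<And>u. u \<in> \<L> \<Longrightarrow> attracting_nbhd \<theta> (K u)"
  shows "bounded_sublattice {U. attracting_nbhd \<theta> U} (\<inter>) (\<union>) {} UNIV (generated_lattice K \<L>)"
proof (intro bounded_sublattice.intro bounded_sublattice_axioms.intro attracting_nbhd_lattice
    generated_lattice_bounds generated_lattice_Int generated_lattice_Un)
  show "generated_lattice K \<L> \<subseteq> {U. attracting_nbhd \<theta> U}"
    by (rule generated_lattice_least)
      (use assms in \<open>auto intro: attracting_nbhd_Int attracting_nbhd_Un\<close>)
qed

theorem theorem5p24:
  fixes \<phi> :: "real \<Rightarrow> real \<Rightarrow> 'x::metric_space \<Rightarrow> 'y::metric_space \<Rightarrow> 'x"
    and \<psi> :: "real \<Rightarrow> 'y \<Rightarrow> 'y"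
    and \<L> :: "('x, 'y) cascade_elem set"
    and K :: "('x, 'y) cascade_elem \<Rightarrow> ('x \<times> 'y) set"
    and \<epsilon>\<^sub>1 :: "('x, 'y) cascade_elem \<Rightarrow> real"
    and \<epsilon> :: real
  assumes "fast_slow \<phi> \<psi>"
    and "finite \<L>"
    and "sub_meet_semilattice \<phi> \<psi> \<L>"
    and "\<And>u. u \<in> \<L> \<Longrightarrow> K u \<in> SANbhd (skew \<phi> \<psi>)"
    and "\<And>u. u \<in> \<L> \<Longrightarrow> associated_nbhd \<phi> \<psi> u (K u)"
    and "\<And>u. u \<in> \<L> \<Longrightarrow> attracting_threshold (skew \<phi> \<psi>) (K u) (\<epsilon>\<^sub>1 u)"
    and "0 < \<epsilon>" and "\<epsilon> \<le> Min (\<epsilon>\<^sub>1 ` \<L>)"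
  shows "bounded_lattice_hom
           (generated_lattice K \<L>) (\<inter>) (\<union>) {} UNIV
           (Att (skew \<phi> \<psi> \<epsilon>)) (att_meet (skew \<phi> \<psi> \<epsilon>)) (\<union>) {} (omega_limit (skew \<phi> \<psi> \<epsilon>) UNIV)
           (\<lambda>N. Inv N (skew \<phi> \<psi> \<epsilon>)) \<and>
         finite ((\<lambda>N. Inv N (skew \<phi> \<psi> \<epsilon>)) ` generated_lattice K \<L>) \<and>
         bounded_sublattice
           (Att (skew \<phi> \<psi> \<epsilon>)) (att_meet (skew \<phi> \<psi> \<epsilon>)) (\<union>) {} (omega_limit (skew \<phi> \<psi> \<epsilon>) UNIV)
           ((\<lambda>N. Inv N (skew \<phi> \<psi> \<epsilon>)) ` generated_lattice K \<L>)"
proof -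
  let ?\<theta> = "skew \<phi> \<psi> \<epsilon>"
  have flow: "semiflow ?\<theta>"
    using assms(1,7) by (simp add: fast_slow_def)
  have "compact ((UNIV :: 'x set) \<times> (UNIV :: 'y set))"
    using assms(1) by (intro compact_Times) (simp_all add: fast_slow_def)
  then have cpt: "compact (UNIV :: ('x \<times> 'y) set)" by simp
  have "attracting_nbhd ?\<theta> (K u)" if u: "u \<in> \<L>" for u
  proof -
    have "\<epsilon> \<le> \<epsilon>\<^sub>1 u"
      using assms(2,8) u by (meson Min_le finite_imageI imageI order_trans)
    then show ?thesis
      using assms(6)[OF u] assms(7) by (simp add: attracting_threshold_def)
  qed
  then have hom: "bounded_lattice_hom
      (generated_lattice K \<L>) (\<inter>) (\<union>) {} UNIV
      (Att ?\<theta>) (att_meet ?\<theta>) (\<union>) {} (omega_limit ?\<theta> UNIV) (\<lambda>N. Inv N ?\<theta>)"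
    by (intro Inv_lattice_hom[OF flow cpt] generated_lattice_attracting_sublattice)
  then show ?thesis
    using finite_generated_lattice[OF assms(2)] bounded_lattice_hom_image_sublattice[OF hom]
    by blast
qed

end
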